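(* Let $\mathbb{F}_q$ be a finite field with $q$ elements (of any prime characteristic $p$), and let $n,k,r$ be positive integers. Then $$|\overline{\mathcal{P}_{(n,1,k),r}}|=|\overline{\mathcal{P}_{(n,1,1),r}}|\,\left|\mathbb{P}^{k-1}(\mathbb{F}_q)\right|=\frac{(q^n-1)(q^k-1)}{(q-1)^2}.$$
   Context: For a field $\mathbb{F}$, $S^r(\mathbb{F}^n)$ denotes the space of homogeneous polynomials of degree $r$ in $x_1,\dots,x_n$ over $\mathbb{F}$ (including $0$). For positive integers $n,m,k,r$, the neuromanifold $\mathcal{P}_{(n,m,k),r}\subseteq (S^r(\mathbb{F}_q^n))^k$ is the set of all $k$-tuples of polynomials $(f_1,\dots,f_k)$ of the form $f_i=\sum_{s=1}^m b_{is}(a_{s1}x_1+\dots+a_{sn}x_n)^r$, $i=1,\dots,k$, with $(a_{sj})\in\mathbb{F}_q^{m\times n}$ and $(b_{is})\in\mathbb{F}_q^{k\times m}$ arbitrary. Viewing $(S^r(\mathbb{F}_q^n))^k$ as $\mathbb{F}_q^N$ with $N=k\binom{n+r-1}{r}$, $\overline{\mathcal{P}_{(n,m,k),r}}$ denotes the image of $\mathcal{P}_{(n,m,k),r}\setminus\{0\}$ in the projective space $\mathbb{P}^{N-1}(\mathbb{F}_q)$, i.e. its set of classes modulo nonzero scalars. *)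

theory Defs
  imports Complex_Main "HOL-Library.Poly_Mapping" "HOL-Library.Function_Algebras"
    "HOL-Library.Cardinality"
begin

text \<open>
  A polynomial is a finitely supported map from monomials to coefficients; a monomial is a
  finitely supported map from (indices of) variables to exponents. Multiplication is the
  convolution product of \<^type>\<open>poly_mapping\<close>.
\<close>

type_synonym 'a mpoly = "(nat \<Rightarrow>\<^sub>0 nat) \<Rightarrow>\<^sub>0 'a"

definition Const :: "'a::zero \<Rightarrow> 'a mpoly" where
  "Const c = Poly_Mapping.single 0 c"

definition Var :: "nat \<Rightarrow> 'a::zero_neq_one mpoly" where
  "Var j = Poly_Mapping.single (Poly_Mapping.single j 1) 1"

definition monom_degree :: "(nat \<Rightarrow>\<^sub>0 nat) \<Rightarrow> nat" where
  "monom_degree t = (\<Sum>j\<in>Poly_Mapping.keys t. Poly_Mapping.lookup t j)"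

text \<open>\<open>hom_polys r n\<close> is $S^r(F^n)$, with variables indexed by \<open>{1..n}\<close>.\<close>

definition hom_polys :: "nat \<Rightarrow> nat \<Rightarrow> 'a::zero mpoly set" where
  "hom_polys r n =
     {p. \<forall>t\<in>Poly_Mapping.keys p. Poly_Mapping.keys t \<subseteq> {1..n} \<and> monom_degree t = r}"

text \<open>
  A \<open>k\<close>-tuple over \<open>X\<close> is a function on \<open>{1..k}\<close> with values in \<open>X\<close>, extended by \<open>0\<close> to all of
  \<^typ>\<open>nat\<close>; so the zero tuple is the zero function.
\<close>

definition tuples :: "nat \<Rightarrow> 'b::zero set \<Rightarrow> (nat \<Rightarrow> 'b) set" where
  "tuples k X = {v. (\<forall>i\<in>{1..k}. v i \<in> X) \<and> (\<forall>i. i \<notin> {1..k} \<longrightarrow> v i = 0)}"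

text \<open>
  The neuromanifold of the architecture \<open>(n, m, k)\<close> with activation degree \<open>r\<close>. Only the entries
  \<open>a s j\<close> and \<open>b i s\<close> with \<open>i \<in> {1..k}\<close>, \<open>s \<in> {1..m}\<close>, \<open>j \<in> {1..n}\<close> matter.
\<close>

definition neuromanifold :: "nat \<Rightarrow> nat \<Rightarrow> nat \<Rightarrow> nat \<Rightarrow> (nat \<Rightarrow> 'a::field mpoly) set" where
  "neuromanifold n m k r =
     {f \<in> tuples k UNIV. \<exists>(a :: nat \<Rightarrow> nat \<Rightarrow> 'a) (b :: nat \<Rightarrow> nat \<Rightarrow> 'a). \<forall>i\<in>{1..k}.
        f i = (\<Sum>s=1..m. Const (b i s) * (\<Sum>j=1..n. Const (a s j) * Var j) ^ r)}"

text \<open>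
  Classes modulo nonzero scalars, with respect to a scalar multiplication \<open>scale\<close>, of the
  nonzero elements of \<open>X\<close>.
\<close>

definition projectivization :: "('a::zero \<Rightarrow> 'v \<Rightarrow> 'v) \<Rightarrow> 'v::zero set \<Rightarrow> 'v set set" where
  "projectivization scale X = (\<lambda>v. {scale c v |c. c \<noteq> 0}) ` (X - {0})"

definition projective_space :: "nat \<Rightarrow> (nat \<Rightarrow> 'a::field) set set" where
  "projective_space d = projectivization (\<lambda>c v i. c * v i) (tuples (d + 1) UNIV)"

definition proj_neuromanifold ::
    "nat \<Rightarrow> nat \<Rightarrow> nat \<Rightarrow> nat \<Rightarrow> (nat \<Rightarrow> 'a::field mpoly) set set" where
  "proj_neuromanifold n m k r =
     projectivization (\<lambda>c f i. Const c * f i) (neuromanifold n m k r)"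

lemma monom_degree_add: "monom_degree (s + t) = monom_degree s + monom_degree t"
proof -
  let ?K = "Poly_Mapping.keys s \<union> Poly_Mapping.keys t"
  have *: "monom_degree u = (\<Sum>j\<in>?K. Poly_Mapping.lookup u j)"
    if "Poly_Mapping.keys u \<subseteq> ?K" for u
    unfolding monom_degree_def
    by (rule sum.mono_neutral_left) (use that in \<open>auto simp: in_keys_iff\<close>)
  show ?thesis
    using Poly_Mapping.keys_add[of s t] by (simp add: * lookup_add sum.distrib)
qed

lemma hom_polys_mult:
  assumes "p \<in> hom_polys r n" "p' \<in> hom_polys r' n"
  shows "p * p' \<in> hom_polys (r + r') n"
  unfolding hom_polys_def
proof (intro CollectI ballI)
  fix t assume "t \<in> Poly_Mapping.keys (p * p')"
  then obtain u v where "t = u + v" "u \<in> Poly_Mapping.keys p" "v \<in> Poly_Mapping.keys p'"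
    using keys_mult[of p p'] by blast
  then show "Poly_Mapping.keys t \<subseteq> {1..n} \<and> monom_degree t = r + r'"
    using assms Poly_Mapping.keys_add[of u v]
    by (fastforce simp: hom_polys_def monom_degree_add)
qed

lemma hom_polys_sum:
  assumes "\<And>i. i \<in> I \<Longrightarrow> p i \<in> hom_polys r n"
  shows "sum p I \<in> hom_polys r n"
  using assms
proof (induction I rule: infinite_finite_induct)
  case (insert x I)
  then show ?case
    using Poly_Mapping.keys_add[of "p x" "sum p I"] by (fastforce simp: hom_polys_def)
qed (auto simp: hom_polys_def)

lemma Const_in_hom_polys: "Const c \<in> hom_polys 0 n"
  by (auto simp: Const_def hom_polys_def monom_degree_def)

lemma Var_in_hom_polys: "j \<in> {1..n} \<Longrightarrow> Var j \<in> hom_polys 1 n"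
  by (auto simp: Var_def hom_polys_def monom_degree_def)

lemma hom_polys_power: "p \<in> hom_polys d n \<Longrightarrow> p ^ r \<in> hom_polys (r * d) n"
proof (induction r)
  case 0
  then show ?case by (simp add: hom_polys_def monom_degree_def)
next
  case (Suc r)
  then show ?case using hom_polys_mult[of p d n "p ^ r" "r * d"] by simp
qed

lemma neuromanifold_subset: "neuromanifold n m k r \<subseteq> tuples k (hom_polys r n)"
proof -
  have "(\<Sum>j=1..n. Const (a s j) * Var j) \<in> hom_polys 1 n" for a :: "nat \<Rightarrow> nat \<Rightarrow> 'a" and s
    by (rule hom_polys_sum) (use hom_polys_mult[OF Const_in_hom_polys Var_in_hom_polys] in simp)
  from hom_polys_mult[OF Const_in_hom_polys hom_polys_power[OF this]]
  have "(\<Sum>s=1..m. Const (b i s) * (\<Sum>j=1..n. Const (a s j) * Var j) ^ r) \<in> hom_polys r n"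
    for a b :: "nat \<Rightarrow> nat \<Rightarrow> 'a" and i
    by (intro hom_polys_sum) simp
  then show ?thesis
    by (auto simp: neuromanifold_def tuples_def)
qed

end

theory Submission
  imports Defs "HOL-Library.FuncSet"
begin

text \<open>
  With one hidden unit, the nonzero points of the neuromanifold are the tuples
  $(b_1 L_a^r, \dots, b_k L_a^r)$ with $a, b \neq 0$, where $L_a$ is the linear form with coefficient
  vector $a$. Up to scalars such a tuple determines $a$ and $b$ up to scalars: evaluating at points of
  $F^n$ recovers the zero set of $L_a$, and a hyperplane determines its linear form up to a scalar.
  No factorization theory is needed, and the characteristic plays no role. Hence
  the classes are in bijection with $P^{n-1} \times P^{k-1}$.
\<close>

section \<open>Evaluation of polynomials at points, as a ring homomorphism\<close>

definition eval_monom :: "(nat \<Rightarrow> 'a::comm_semiring_1) \<Rightarrow> (nat \<Rightarrow>\<^sub>0 nat) \<Rightarrow> 'a" where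
  "eval_monom x t = (\<Prod>j\<in>Poly_Mapping.keys t. x j ^ Poly_Mapping.lookup t j)"

definition eval_mpoly :: "(nat \<Rightarrow> 'a::comm_semiring_1) \<Rightarrow> 'a mpoly \<Rightarrow> 'a" where
  "eval_mpoly x p = (\<Sum>t\<in>Poly_Mapping.keys p. Poly_Mapping.lookup p t * eval_monom x t)"

text \<open>Extra indices contribute factors \<open>x j ^ 0 = 1\<close>. Two monomials with
  different supports can thus be evaluated over the union of their keys, where exponents add
  pointwise.\<close>

lemma eval_monom_superset:
  assumes "finite K" "Poly_Mapping.keys t \<subseteq> K"
  shows "eval_monom x t = (\<Prod>j\<in>K. x j ^ Poly_Mapping.lookup t j)"
  unfolding eval_monom_def
  by (rule prod.mono_neutral_left) (use assms in \<open>auto simp: in_keys_iff\<close>)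

lemma eval_monom_add: "eval_monom x (s + t) = eval_monom x s * eval_monom x t"
proof -
  let ?K = "Poly_Mapping.keys s \<union> Poly_Mapping.keys t"
  show ?thesis
    using Poly_Mapping.keys_add[of s t]
    by (simp add: eval_monom_superset[of ?K] lookup_add power_add prod.distrib)
qed

lemma eval_mpoly_superset:
  assumes "finite K" "Poly_Mapping.keys p \<subseteq> K"
  shows "eval_mpoly x p = (\<Sum>t\<in>K. Poly_Mapping.lookup p t * eval_monom x t)"
  unfolding eval_mpoly_def
  by (rule sum.mono_neutral_left) (use assms in \<open>auto simp: in_keys_iff\<close>)

lemma eval_mpoly_zero [simp]: "eval_mpoly x 0 = 0"
  by (simp add: eval_mpoly_def)

lemma eval_mpoly_add: "eval_mpoly x (p + p') = eval_mpoly x p + eval_mpoly x p'"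
proof -
  let ?K = "Poly_Mapping.keys p \<union> Poly_Mapping.keys p'"
  show ?thesis
    using Poly_Mapping.keys_add[of p p']
    by (simp add: eval_mpoly_superset[of ?K] lookup_add distrib_right sum.distrib)
qed

lemma eval_mpoly_sum: "eval_mpoly x (\<Sum>i\<in>I. p i) = (\<Sum>i\<in>I. eval_mpoly x (p i))"
  by (induction I rule: infinite_finite_induct) (auto simp: eval_mpoly_add)

lemma eval_mpoly_single: "eval_mpoly x (Poly_Mapping.single t c) = c * eval_monom x t"
  by (simp add: eval_mpoly_superset[of "{t}"])

lemma mpoly_sum_single:
  "p = (\<Sum>t\<in>Poly_Mapping.keys p. Poly_Mapping.single t (Poly_Mapping.lookup p t))"
  by (rule poly_mapping_eqI)
    (simp add: lookup_sum lookup_single when_def in_keys_iff)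

lemma eval_mpoly_mult: "eval_mpoly x (p * p') = eval_mpoly x p * eval_mpoly x p'"
proof -
  let ?K = "Poly_Mapping.keys p" and ?K' = "Poly_Mapping.keys p'"
  \<comment> \<open>Both factors are split into single terms, which turns the convolution into a
    double sum. Different pairs may give the same monomial \<open>s + t\<close>; additivity of
    evaluation takes care of this.\<close>
  have "p * p' = (\<Sum>s\<in>?K. \<Sum>t\<in>?K'. Poly_Mapping.single (s + t)
                    (Poly_Mapping.lookup p s * Poly_Mapping.lookup p' t))"
    using arg_cong2[OF mpoly_sum_single[of p] mpoly_sum_single[of p'], of "(*)"]
    unfolding sum_product mult_single .
  then have "eval_mpoly x (p * p') =
      (\<Sum>s\<in>?K. \<Sum>t\<in>?K'. (Poly_Mapping.lookup p s * eval_monom x s) *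
                          (Poly_Mapping.lookup p' t * eval_monom x t))"
    by (simp add: eval_mpoly_sum eval_mpoly_single eval_monom_add mult_ac)
  then show ?thesis
    by (simp add: eval_mpoly_def sum_product)
qed

lemma eval_mpoly_Const [simp]: "eval_mpoly x (Const c) = c"
  by (simp add: Const_def eval_mpoly_single eval_monom_def)

lemma eval_mpoly_Var [simp]: "eval_mpoly x (Var j) = x j"
  by (simp add: Var_def eval_mpoly_single eval_monom_def)

lemma eval_mpoly_power: "eval_mpoly x (p ^ r) = eval_mpoly x p ^ r"
proof (induction r)
  case 0
  then show ?case using eval_mpoly_Const[of x 1] by (simp add: Const_def)
qed (simp add: eval_mpoly_mult)

section \<open>Scalars and linear forms\<close>

lemma Const_0 [simp]: "Const 0 = 0"
  by (simp add: Const_def)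

lemma Const_1 [simp]: "Const 1 = 1"
  by (simp add: Const_def)

lemma Const_mult: "Const (c * d :: 'a::comm_semiring_1) = Const c * Const d"
  by (simp add: Const_def mult_single)

lemma Const_power: "Const (c ^ r :: 'a::comm_semiring_1) = Const c ^ r"
  by (induction r) (simp_all add: Const_mult)

definition linear_form :: "nat \<Rightarrow> (nat \<Rightarrow> 'a::comm_semiring_1) \<Rightarrow> 'a mpoly" where
  "linear_form n a = (\<Sum>j=1..n. Const (a j) * Var j)"

lemma eval_linear_form: "eval_mpoly x (linear_form n a) = (\<Sum>j=1..n. a j * x j)"
  by (simp add: linear_form_def eval_mpoly_sum eval_mpoly_mult)

lemma linear_form_scale: "linear_form n (\<lambda>j. c * a j) = Const c * linear_form n a"
  by (simp add: linear_form_def Const_mult sum_distrib_left mult_ac)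

lemma tuples_eqI:
  assumes "v \<in> tuples n X" "w \<in> tuples n X" "\<And>i. i \<in> {1..n} \<Longrightarrow> v i = w i"
  shows "v = w"
proof
  show "v i = w i" for i
    using assms by (cases "i \<in> {1..n}") (auto simp: tuples_def)
qed

lemma tuples_nonzeroE:
  assumes "v \<in> tuples n X" "v \<noteq> 0"
  obtains i where "i \<in> {1..n}" "v i \<noteq> 0"
proof -
  obtain i where "v i \<noteq> 0"
    using assms(2) by (auto simp: fun_eq_iff)
  moreover from this have "i \<in> {1..n}"
    using assms(1) unfolding tuples_def by blast
  ultimately show thesis using that by blast
qed

text \<open>The unit vector at an index with nonzero coefficient picks out that coefficient.\<close>

lemma linear_form_nonzero_value:
  fixes a :: "nat \<Rightarrow> 'a::comm_semiring_1"
  assumes "a \<in> tuples n UNIV" "a \<noteq> 0"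
  obtains x where "eval_mpoly x (linear_form n a) \<noteq> 0"
proof -
  obtain j where j: "j \<in> {1..n}" "a j \<noteq> 0"
    using tuples_nonzeroE[OF assms] .
  have "(\<Sum>i=1..n. a i * (if i = j then 1 else 0)) = a j"
    using j by (simp add: if_distrib cong: if_cong)
  then show thesis
    using that[of "\<lambda>i. if i = j then 1 else 0"] j by (simp add: eval_linear_form)
qed

text \<open>With \<open>a l\<close> nonzero, the vectors \<open>a l * e_j - a j * e_l\<close> are
  zeros of the form of \<open>a\<close>. That they are zeros of the form of \<open>a'\<close> too
  means \<open>a' j * a l = a' l * a j\<close>, so \<open>a' l / a l\<close> is the factor.\<close>

lemma linear_form_same_zeros:
  fixes a a' :: "nat \<Rightarrow> 'a::field"
  assumes a: "a \<in> tuples n UNIV" "a \<noteq> 0" and a': "a' \<in> tuples n UNIV" "a' \<noteq> 0"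
    and zeros: "\<And>x. eval_mpoly x (linear_form n a) = 0 \<Longrightarrow> eval_mpoly x (linear_form n a') = 0"
  obtains d where "d \<noteq> 0" "a' = (\<lambda>j. d * a j)"
proof -
  obtain l where l: "l \<in> {1..n}" "a l \<noteq> 0"
    using tuples_nonzeroE[OF a] .
  have ratio: "a' j = a' l / a l * a j" if j: "j \<in> {1..n}" for j
  proof -
    let ?x = "\<lambda>i. (if i = j then a l else 0) - (if i = l then a j else 0)"
    have ev: "(\<Sum>i=1..n. c i * ?x i) = c j * a l - c l * a j" for c :: "nat \<Rightarrow> 'a"
      using j l
      by (simp add: right_diff_distrib sum_subtractf if_distrib[of "(*) _"] cong: if_cong)
    have "a' j * a l - a' l * a j = 0"
      using zeros[of ?x] unfolding eval_linear_form ev by (simp add: mult.commute)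
    then show ?thesis
      using l by (simp add: field_simps)
  qed
  \<comment> \<open>Outside \<open>{1..n}\<close> both sides are 0 by the padding of tuples.\<close>
  have eq: "a' = (\<lambda>j. a' l / a l * a j)"
    by (rule tuples_eqI[OF a'(1)]) (use a ratio in \<open>auto simp: tuples_def\<close>)
  moreover have "a' l / a l \<noteq> 0"
  proof
    assume "a' l / a l = 0"
    then have "a' = 0" by (subst eq) (auto simp: fun_eq_iff)
    with a' show False by simp
  qed
  ultimately show thesis using that by blast
qed

section \<open>One hidden unit: parametrization, scalar classes and their number\<close>

definition power_tuple ::
    "nat \<Rightarrow> nat \<Rightarrow> (nat \<Rightarrow> 'a::comm_semiring_1) \<Rightarrow> (nat \<Rightarrow> 'a) \<Rightarrow> nat \<Rightarrow> 'a mpoly" where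
  "power_tuple n r a b = (\<lambda>i. Const (b i) * linear_form n a ^ r)"

lemma eval_power_tuple:
  "eval_mpoly x (power_tuple n r a b i) = b i * eval_mpoly x (linear_form n a) ^ r"
  by (simp add: power_tuple_def eval_mpoly_mult eval_mpoly_power)

lemma neuromanifold_one_hidden:
  "(neuromanifold n 1 k r :: (nat \<Rightarrow> 'a::field mpoly) set) =
     (\<lambda>(a, b). power_tuple n r a b) ` (tuples n UNIV \<times> tuples k UNIV)"
proof (intro equalityI subsetI)
  fix f :: "nat \<Rightarrow> 'a mpoly" assume "f \<in> neuromanifold n 1 k r"
  then obtain a b where f: "f \<in> tuples k UNIV"
    and ab: "\<And>i. i \<in> {1..k} \<Longrightarrow> f i = Const (b i 1) * (\<Sum>j=1..n. Const (a 1 j) * Var j) ^ r"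
    by (auto simp: neuromanifold_def)
  \<comment> \<open>The given weights are arbitrary outside the index ranges; padding them by 0
    makes them tuples without changing \<open>f\<close>.\<close>
  define a' where "a' j = (if j \<in> {1..n} then a 1 j else 0)" for j
  define b' where "b' i = (if i \<in> {1..k} then b i 1 else 0)" for i
  have "linear_form n a' = (\<Sum>j=1..n. Const (a 1 j) * Var j)"
    by (simp add: linear_form_def a'_def)
  then have "f = power_tuple n r a' b'"
    using f ab by (auto simp: power_tuple_def b'_def tuples_def fun_eq_iff)
  moreover have "a' \<in> tuples n UNIV" "b' \<in> tuples k UNIV"
    by (auto simp: tuples_def a'_def b'_def)
  ultimately show "f \<in> (\<lambda>(a, b). power_tuple n r a b) ` (tuples n UNIV \<times> tuples k UNIV)"
    by auto
next
  fix f :: "nat \<Rightarrow> 'a mpoly"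
  assume "f \<in> (\<lambda>(a, b). power_tuple n r a b) ` (tuples n UNIV \<times> tuples k UNIV)"
  then obtain a b where "a \<in> tuples n UNIV" and b: "b \<in> tuples k UNIV"
    and f: "f = power_tuple n r a b"
    by auto
  have "f \<in> tuples k UNIV"
    using b by (auto simp: f power_tuple_def tuples_def)
  then show "f \<in> neuromanifold n 1 k r"
    unfolding neuromanifold_def
    by (intro CollectI conjI exI[of _ "\<lambda>_. a"] exI[of _ "\<lambda>i _. b i"])
      (simp_all add: f power_tuple_def linear_form_def)
qed

text \<open>If \<open>a\<close> and \<open>b\<close> are nonzero, some entry takes the value
  \<open>b i * L(x) ^ r\<close>, where neither \<open>b i\<close> nor the value \<open>L(x)\<close>
  of the linear form is 0; a field has no zero divisors.\<close>

lemma power_tuple_eq_0_iff: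
  fixes a b :: "nat \<Rightarrow> 'a::field"
  assumes "r > 0" "a \<in> tuples n UNIV" "b \<in> tuples k UNIV"
  shows "power_tuple n r a b = 0 \<longleftrightarrow> a = 0 \<or> b = 0"
proof
  assume zero: "power_tuple n r a b = 0"
  show "a = 0 \<or> b = 0"
  proof (rule ccontr)
    assume "\<not> (a = 0 \<or> b = 0)"
    then obtain x i where "eval_mpoly x (linear_form n a) \<noteq> 0" "b i \<noteq> 0"
      using assms linear_form_nonzero_value tuples_nonzeroE by metis
    then show False
      using eval_power_tuple[of x n r a b i] by (simp add: zero)
  qed
next
  assume "a = 0 \<or> b = 0"
  then show "power_tuple n r a b = 0"
    \<comment> \<open>For \<open>a = 0\<close> positivity of \<open>r\<close> matters, since
      \<open>0 ^ 0 = 1\<close>.\<close>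
    using assms(1) by (auto simp: power_tuple_def linear_form_def fun_eq_iff zero_power)
qed

lemma neuromanifold_one_hidden_nonzero:
  assumes "r > 0"
  shows "(neuromanifold n 1 k r - {0} :: (nat \<Rightarrow> 'a::field mpoly) set) =
     (\<lambda>(a, b). power_tuple n r a b) ` ((tuples n UNIV - {0}) \<times> (tuples k UNIV - {0}))"
proof -
  have "power_tuple n r a b = 0 \<longleftrightarrow> a = 0 \<or> b = 0"
    if "(a, b) \<in> tuples n UNIV \<times> tuples k UNIV" for a b :: "nat \<Rightarrow> 'a"
    using that power_tuple_eq_0_iff[OF assms] by blast
  then show ?thesis
    unfolding neuromanifold_one_hidden by fast
qed

text \<open>Kept abstract in \<open>scale\<close> to serve both tuples of scalars and tuples of
  polynomials.\<close>

lemma scalar_class_eq_iff: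
  fixes scale :: "'a::field \<Rightarrow> 'v \<Rightarrow> 'v"
  assumes one: "\<And>v. scale 1 v = v" and mult: "\<And>c d v. scale c (scale d v) = scale (c * d) v"
  shows "{scale c v |c. c \<noteq> 0} = {scale c w |c. c \<noteq> 0} \<longleftrightarrow> (\<exists>c. c \<noteq> 0 \<and> w = scale c v)"
proof
  assume "{scale c v |c. c \<noteq> 0} = {scale c w |c. c \<noteq> 0}"
  moreover have "w \<in> {scale c w |c. c \<noteq> 0}"
    using one[of w] by (metis (mono_tags, lifting) mem_Collect_eq zero_neq_one)
  ultimately show "\<exists>c. c \<noteq> 0 \<and> w = scale c v" by blast
next
  assume "\<exists>c. c \<noteq> 0 \<and> w = scale c v"
  then obtain d where d: "d \<noteq> 0" "w = scale d v" by blast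
  \<comment> \<open>Passing between \<open>c\<close> and \<open>c / d\<close>, or \<open>c\<close>
    and \<open>c * d\<close>, preserves nonzero scalars and gives the two inclusions.\<close>
  have "scale c v = scale (c / d) w" "scale c w = scale (c * d) v" for c
    using d by (simp_all add: mult)
  then show "{scale c v |c. c \<noteq> 0} = {scale c w |c. c \<noteq> 0}"
    using d(1) by (auto; metis divide_eq_0_iff mult_eq_0_iff)
qed

text \<open>Forward, evaluation shows that zeros of the form of \<open>a\<close> are zeros of the
  form of \<open>a'\<close>, so \<open>a'\<close> is a multiple of \<open>a\<close>; then
  \<open>b'\<close> is compared with \<open>b\<close> at one point where the form of
  \<open>a\<close> is nonzero. Backward, the factors combine to \<open>e * d ^ r\<close>.\<close>

lemma power_tuple_proportional_iff:
  fixes a b a' b' :: "nat \<Rightarrow> 'a::field"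
  assumes r: "r > 0"
    and a: "a \<in> tuples n UNIV" "a \<noteq> 0" and b: "b \<in> tuples k UNIV" "b \<noteq> 0"
    and a': "a' \<in> tuples n UNIV" "a' \<noteq> 0"
  shows "(\<exists>c. c \<noteq> 0 \<and> power_tuple n r a' b' = (\<lambda>i. Const c * power_tuple n r a b i)) \<longleftrightarrow>
         (\<exists>d. d \<noteq> 0 \<and> a' = (\<lambda>i. d * a i)) \<and> (\<exists>e. e \<noteq> 0 \<and> b' = (\<lambda>i. e * b i))"
    (is "?L \<longleftrightarrow> ?R")
proof
  assume ?L
  then obtain c where c: "c \<noteq> 0"
    and eq: "power_tuple n r a' b' = (\<lambda>i. Const c * power_tuple n r a b i)" by blast
  have ev: "b' i * eval_mpoly x (linear_form n a') ^ r =
      c * (b i * eval_mpoly x (linear_form n a) ^ r)" for x i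
    using arg_cong[OF fun_cong[OF eq, of i], of "eval_mpoly x"]
    by (simp add: eval_power_tuple eval_mpoly_mult)
  obtain i where i: "b i \<noteq> 0" using tuples_nonzeroE[OF b] .
  obtain x where x: "eval_mpoly x (linear_form n a) \<noteq> 0"
    using linear_form_nonzero_value[OF a] .
  have "b' i \<noteq> 0"
    using ev[of i x] c i x by auto
  \<comment> \<open>At such a \<open>y\<close> the right side of \<open>ev\<close> is 0 because
    \<open>r > 0\<close>, and \<open>b' i\<close> can be cancelled on the left.\<close>
  then have "eval_mpoly y (linear_form n a') = 0" if "eval_mpoly y (linear_form n a) = 0" for y
    using ev[of i y] that r by (simp add: zero_power)
  then obtain d where d: "d \<noteq> 0" "a' = (\<lambda>j. d * a j)"
    using linear_form_same_zeros[OF a a'] by blast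
  \<comment> \<open>At \<open>x\<close> the form of \<open>a'\<close> has \<open>d\<close> times the
    value of the form of \<open>a\<close>; the common nonzero power cancels.\<close>
  have "b' j = c / d ^ r * b j" for j
    using ev[of j x] x d(1)
    by (simp add: d(2) linear_form_scale eval_mpoly_mult power_mult_distrib field_simps)
  then have "b' = (\<lambda>j. c / d ^ r * b j)" by blast
  moreover have "c / d ^ r \<noteq> 0" using c d by simp
  ultimately show ?R using d by blast
next
  assume ?R
  then obtain d e where de: "d \<noteq> 0" "e \<noteq> 0" "a' = (\<lambda>i. d * a i)" "b' = (\<lambda>i. e * b i)"
    by blast
  then have "power_tuple n r a' b' = (\<lambda>i. Const (e * d ^ r) * power_tuple n r a b i)"
    by (simp add: power_tuple_def linear_form_scale power_mult_distrib Const_mult Const_power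
        mult_ac)
  moreover have "e * d ^ r \<noteq> 0" using de by simp
  ultimately show ?L by blast
qed

text \<open>A value of \<open>f\<close> is sent to the value of \<open>g\<close> at a chosen
  preimage; equality of fibres makes the choice irrelevant and the map invertible.\<close>

lemma card_image_eq_if_same_fibres:
  assumes "\<And>x y. x \<in> S \<Longrightarrow> y \<in> S \<Longrightarrow> f x = f y \<longleftrightarrow> g x = g y"
  shows "card (f ` S) = card (g ` S)"
proof (rule bij_betw_same_card)
  show "bij_betw (\<lambda>z. g (inv_into S f z)) (f ` S) (g ` S)"
    by (rule bij_betw_byWitness[where f' = "\<lambda>z. f (inv_into S g z)"])
      (auto simp: assms inv_into_into f_inv_into_f,
       (metis assms f_inv_into_f imageI inv_into_into)+)
qed

lemma card_proj_neuromanifold_one_hidden: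
  assumes "n > 0" "k > 0" "r > 0"
  shows "card (proj_neuromanifold n 1 k r :: (nat \<Rightarrow> 'a::field mpoly) set set) =
    card (projective_space (n - 1) :: (nat \<Rightarrow> 'a) set set) *
    card (projective_space (k - 1) :: (nat \<Rightarrow> 'a) set set)"
proof -
  define S :: "((nat \<Rightarrow> 'a) \<times> (nat \<Rightarrow> 'a)) set"
    where "S = (tuples n UNIV - {0}) \<times> (tuples k UNIV - {0})"
  define cl :: "(nat \<Rightarrow> 'a) \<Rightarrow> (nat \<Rightarrow> 'a) set" where "cl v = {\<lambda>i. c * v i |c. c \<noteq> 0}" for v
  define Cl :: "(nat \<Rightarrow> 'a mpoly) \<Rightarrow> (nat \<Rightarrow> 'a mpoly) set"
    where "Cl f = {\<lambda>i. Const c * f i |c. c \<noteq> 0}" for f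
  have cl_eq: "cl v = cl w \<longleftrightarrow> (\<exists>c. c \<noteq> 0 \<and> w = (\<lambda>i. c * v i))" for v w
    unfolding cl_def by (rule scalar_class_eq_iff) (simp_all add: mult.assoc)
  have Cl_eq: "Cl f = Cl g \<longleftrightarrow> (\<exists>c. c \<noteq> 0 \<and> g = (\<lambda>i. Const c * f i))" for f g
    unfolding Cl_def by (rule scalar_class_eq_iff) (simp_all add: Const_mult mult.assoc)
  have "proj_neuromanifold n 1 k r = (\<lambda>(a, b). Cl (power_tuple n r a b)) ` S"
    unfolding proj_neuromanifold_def projectivization_def
      neuromanifold_one_hidden_nonzero[OF assms(3)] S_def Cl_def
    by (simp add: image_image case_prod_unfold)
  also have "card \<dots> = card ((\<lambda>(a, b). (cl a, cl b)) ` S)"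
  \<comment> \<open>The class of a power tuple and the pair of classes of its parameters induce the
    same equivalence on \<open>S\<close>, so their images have equal size.\<close>
  proof (rule card_image_eq_if_same_fibres, clarify)
    fix a b a' b' assume "(a, b) \<in> S" "(a', b') \<in> S"
    then show "Cl (power_tuple n r a b) = Cl (power_tuple n r a' b') \<longleftrightarrow>
        (cl a, cl b) = (cl a', cl b')"
      unfolding Cl_eq prod.inject cl_eq
      by (intro power_tuple_proportional_iff[where k=k] assms) (auto simp: S_def)
  qed
  also have "(\<lambda>(a, b). (cl a, cl b)) ` S = projective_space (n - 1) \<times> projective_space (k - 1)"
    \<comment> \<open>\<open>projective_space d\<close> uses tuples of length \<open>d + 1\<close>;
      positivity gives \<open>n - 1 + 1 = n\<close>, and likewise for \<open>k\<close>.\<close>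
    using assms by (auto simp: S_def projective_space_def projectivization_def cl_def)
  finally show ?thesis by (simp add: card_cartesian_product)
qed

section \<open>Counting the points of projective space\<close>

lemma
  fixes k :: nat
  shows finite_tuples: "finite (tuples k UNIV :: (nat \<Rightarrow> 'a::{zero,finite}) set)"
    and card_tuples: "card (tuples k UNIV :: (nat \<Rightarrow> 'a::{zero,finite}) set) = CARD('a) ^ k"
proof -
  \<comment> \<open>Tuples default to 0 outside \<open>{1..k}\<close>, extensional functions to
    \<open>undefined\<close>; \<open>restrict\<close> exchanges the defaults.\<close>
  have bij: "bij_betw (\<lambda>v. restrict v {1..k}) (tuples k UNIV :: (nat \<Rightarrow> 'a) set)
      ({1..k} \<rightarrow>\<^sub>E UNIV)"
    by (rule bij_betw_byWitness[where f' = "\<lambda>w i. if i \<in> {1..k} then w i else 0"])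
      (auto simp: tuples_def fun_eq_iff PiE_def extensional_def)
  then show "card (tuples k UNIV :: (nat \<Rightarrow> 'a) set) = CARD('a) ^ k"
    by (simp add: bij_betw_same_card card_PiE)
  show "finite (tuples k UNIV :: (nat \<Rightarrow> 'a) set)"
    using bij_betw_finite[OF bij] by (simp add: finite_PiE)
qed

text \<open>The scalar classes partition the nonzero vectors into blocks of size
  \<open>CARD('a) - 1\<close>. The product form avoids division of natural numbers.\<close>

lemma card_projective_space:
  "(CARD('a) - 1) * card (projective_space d :: (nat \<Rightarrow> 'a::{field,finite}) set set) =
     CARD('a) ^ (d + 1) - 1"
proof -
  let ?T = "tuples (d + 1) UNIV - {0} :: (nat \<Rightarrow> 'a) set"
  define cl :: "(nat \<Rightarrow> 'a) \<Rightarrow> (nat \<Rightarrow> 'a) set" where "cl v = {\<lambda>i. c * v i |c. c \<noteq> 0}" for v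
  have P: "projective_space d = cl ` ?T"
    by (simp add: projective_space_def projectivization_def cl_def)
  have cl_eq: "cl v = cl w \<longleftrightarrow> (\<exists>c. c \<noteq> 0 \<and> w = (\<lambda>i. c * v i))" for v w
    unfolding cl_def by (rule scalar_class_eq_iff) (simp_all add: mult.assoc)
  have cl_mem: "w \<in> cl v \<longleftrightarrow> cl v = cl w" for v w
    unfolding cl_eq by (auto simp: cl_def)
  have cl_sub: "cl v \<subseteq> ?T" if v: "v \<in> ?T" for v
  proof -
    obtain i where "v i \<noteq> 0" using v tuples_nonzeroE[of v "d + 1" UNIV] by blast
    with v show ?thesis
      by (auto simp: cl_def tuples_def fun_eq_iff)
  qed
  have card_cl: "card (cl v) = CARD('a) - 1" if v: "v \<in> ?T" for v
  proof -
    obtain i where i: "v i \<noteq> 0" using v tuples_nonzeroE[of v "d + 1" UNIV] by blast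
    have "cl v = (\<lambda>c i. c * v i) ` (UNIV - {0})" by (auto simp: cl_def)
    \<comment> \<open>The scalar \<open>c\<close> is recovered from the nonzero coordinate
      \<open>i\<close>.\<close>
    moreover have "inj_on (\<lambda>c i. c * v i) (UNIV - {0})"
      using i by (auto simp: inj_on_def fun_eq_iff)
    ultimately show ?thesis by (simp add: card_image card_Diff_singleton)
  qed
  have un: "\<Union>(cl ` ?T) = ?T"
    using cl_sub cl_mem by blast
  have "(CARD('a) - 1) * card (cl ` ?T) = card (\<Union>(cl ` ?T))"
  proof (rule card_partition)
    show "finite (cl ` ?T)" "finite (\<Union>(cl ` ?T))"
      unfolding un by (simp_all add: finite_tuples)
    show "card c = CARD('a) - 1" if "c \<in> cl ` ?T" for c
      using that card_cl by blast
    show "c \<inter> c' = {}" if "c \<in> cl ` ?T" "c' \<in> cl ` ?T" "c \<noteq> c'" for c c'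
      using that cl_mem by (auto 0 3)
  qed
  also have "\<dots> = CARD('a) ^ (d + 1) - 1"
  proof -
    have "0 \<in> (tuples (d + 1) UNIV :: (nat \<Rightarrow> 'a) set)" by (simp add: tuples_def)
    then show ?thesis unfolding un by (simp add: card_Diff_singleton card_tuples)
  qed
  finally show ?thesis unfolding P .
qed

lemma card_field_gt_1: "CARD('a::{field,finite}) > 1"
proof -
  have "card {0, 1 :: 'a} \<le> CARD('a)" by (rule card_mono) simp_all
  then show ?thesis by simp
qed

lemma real_card_projective_space:
  "real (card (projective_space d :: (nat \<Rightarrow> 'a::{field,finite}) set set)) =
     (real CARD('a) ^ (d + 1) - 1) / (real CARD('a) - 1)"
proof -
  have gt: "CARD('a) > 1" by (rule card_field_gt_1)
  have "real ((CARD('a) - 1) * card (projective_space d :: (nat \<Rightarrow> 'a) set set)) =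
      real (CARD('a) ^ (d + 1) - 1)"
    unfolding card_projective_space ..
  then have "(real CARD('a) - 1) * real (card (projective_space d :: (nat \<Rightarrow> 'a) set set)) =
      real CARD('a) ^ (d + 1) - 1"
    \<comment> \<open>Since \<open>CARD('a)\<close> is at least 1, no natural subtraction is
      truncated.\<close>
    using gt by (simp only: of_nat_mult of_nat_diff of_nat_power of_nat_1 less_imp_le one_le_power)
  then show ?thesis
    using gt by (simp add: nonzero_eq_divide_eq mult.commute)
qed

theorem lemma4p2:
  fixes n k r q :: nat
  assumes "n > 0" and "k > 0" and "r > 0"
    and "q = CARD('a::{field,finite})"
  shows "card (proj_neuromanifold n 1 k r :: (nat \<Rightarrow> 'a mpoly) set set) =
           card (proj_neuromanifold n 1 1 r :: (nat \<Rightarrow> 'a mpoly) set set) *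
           card (projective_space (k - 1) :: (nat \<Rightarrow> 'a) set set) \<and>
         real (card (proj_neuromanifold n 1 1 r :: (nat \<Rightarrow> 'a mpoly) set set) *
               card (projective_space (k - 1) :: (nat \<Rightarrow> 'a) set set)) =
           (real q ^ n - 1) * (real q ^ k - 1) / (real q - 1)\<^sup>2"
proof -
  \<comment> \<open>For \<open>k = 1\<close> the second factor of the product formula is a single
    point, so \<open>proj_neuromanifold n 1 1 r\<close> has as many elements as
    \<open>projective_space (n - 1)\<close>.\<close>
  have point: "card (projective_space 0 :: (nat \<Rightarrow> 'a) set set) = 1"
    using card_projective_space[of 0, where 'a='a] card_field_gt_1[where 'a='a] by simp
  have n1: "card (proj_neuromanifold n 1 1 r :: (nat \<Rightarrow> 'a mpoly) set set) =
      card (projective_space (n - 1) :: (nat \<Rightarrow> 'a) set set)"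
    using card_proj_neuromanifold_one_hidden[of n 1 r, where 'a='a] assms point by simp
  show ?thesis
    unfolding n1 card_proj_neuromanifold_one_hidden[OF assms(1-3)] of_nat_mult
      real_card_projective_space
    using assms by (simp add: power2_eq_square)
qed

end
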